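(* Assume that $K$ is a p.c.f. self-similar set. Let $f\in L^1_{\rm loc}(K,\mu)$. Then (i) for $\mu$-almost every $x\in K$, $$\lim_{n\to \infty}\frac1{\mu(K_{\mathbf{i}_n}(x))}\int_{K_{\mathbf{i}_n}(x)}f(y)\,d\mu=f(x);$$ (ii) for $\mu$-almost every $x\in K$, $$\lim_{n\to \infty}\frac1{\mu(K_{\mathbf{i}_n}(x))}\int_{K_{\mathbf{i}_n}(x)}|f(y)-f(x)|\,d\mu=0.$$
   Context: Self-similar set and measure. For $1\le i\le m$ let $S_i:\mathbb{R}^d\to\mathbb{R}^d$, $S_i(x)=r_iR_i(x)+b_i$ with $0<r_i<1$, $b_i\in\mathbb{R}^d$, $R_i$ orthogonal. $K\subset\mathbb{R}^d$ is the unique nonempty compact set with $K=\bigcup_{i=1}^m S_i(K)$ (the self-similar set generated by $\{S_i\}_{i=1}^m$). It is always assumed that the $S_i$ do not all share a common fixed point. Given a probability vector $(p_1,\dots,p_m)$ with all $p_i>0$ and $\sum_i p_i=1$, $\mu$ is the unique Borel probability measure with $\mu=\sum_{i=1}^m p_i\,\mu\circ S_i^{-1}$ (self-similar measure; it is supported on $K$). Basic cubes. $\Sigma_n=\{1,\dots,m\}^n$ for $n\ge1$. For $\mathbf{i}=i_1\ldots i_n$, $S_{\mathbf{i}}=S_{i_1}\circ\cdots\circ S_{i_n}$ and $K_{\mathbf{i}}=S_{\mathbf{i}}(K)$. For $x\in K$ and $n\ge1$, $K_{\mathbf{i}_n}(x)$ denotes a (not necessarily unique) basic cube $K_{\mathbf{i}}$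 with $\mathbf{i}\in\Sigma_n$ that contains $x$. P.c.f. Let $\Sigma_\infty=\{1,\dots,m\}^{\mathbb{N}}$, let $\Pi:\Sigma_\infty\to K$ be the coding map, $\{\Pi(\mathbf{i})\}=\bigcap_{n\ge1}K_{i_1\ldots i_n}$, and let $\sigma$ be the shift $\sigma(i_1,i_2,\dots)=(i_2,i_3,\dots)$. Put $\mathcal{C}_K=\bigcup_{i\ne j}(S_i(K)\cap S_j(K))$ and $\mathcal{C}=\Pi^{-1}(\mathcal{C}_K)$. $K$ is post-critically finite (p.c.f.) if $\bigcup_{n\ge1}\sigma^n(\mathcal{C})$ is a finite set. *)

theory Defs
  imports "HOL-Probability.Probability"
begin

definition contracting_similarity :: "('a::euclidean_space \<Rightarrow> 'a) \<Rightarrow> bool" where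
  "contracting_similarity T \<longleftrightarrow>
     (\<exists>r R b. 0 < r \<and> r < 1 \<and> orthogonal_transformation R \<and> T = (\<lambda>x. r *\<^sub>R R x + b))"

text \<open>The maps are indexed by \<open>{1..m}\<close>; values of \<open>S\<close> at other indices are irrelevant. Existence and
  uniqueness of the invariant set and of the invariant measure are Hutchinson's theorem, so the
  predicates below determine \<open>K\<close> and \<open>\<mu>\<close>.\<close>

definition self_similar_set :: "nat \<Rightarrow> (nat \<Rightarrow> 'a::euclidean_space \<Rightarrow> 'a) \<Rightarrow> 'a set \<Rightarrow> bool" where
  "self_similar_set m S K \<longleftrightarrow> K \<noteq> {} \<and> compact K \<and> K = (\<Union>i\<in>{1..m}. S i ` K)"

definition probability_vector :: "nat \<Rightarrow> (nat \<Rightarrow> real) \<Rightarrow> bool" where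
  "probability_vector m p \<longleftrightarrow> (\<forall>i\<in>{1..m}. 0 < p i) \<and> (\<Sum>i\<in>{1..m}. p i) = 1"

definition self_similar_measure ::
  "nat \<Rightarrow> (nat \<Rightarrow> 'a::euclidean_space \<Rightarrow> 'a) \<Rightarrow> (nat \<Rightarrow> real) \<Rightarrow> 'a measure \<Rightarrow> bool" where
  "self_similar_measure m S p \<mu> \<longleftrightarrow>
     prob_space \<mu> \<and> sets \<mu> = sets borel \<and>
     (\<forall>A\<in>sets borel. measure \<mu> A = (\<Sum>i\<in>{1..m}. p i * measure \<mu> (S i -` A)))"

definition words :: "nat \<Rightarrow> nat \<Rightarrow> nat list set" where
  "words m n = {w. length w = n \<and> set w \<subseteq> {1..m}}"

definition word_map :: "(nat \<Rightarrow> 'a \<Rightarrow> 'a) \<Rightarrow> nat list \<Rightarrow> 'a \<Rightarrow> 'a" where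
  "word_map S w = foldr (\<lambda>i g. S i \<circ> g) w id"

definition basic_cube :: "(nat \<Rightarrow> 'a \<Rightarrow> 'a) \<Rightarrow> 'a set \<Rightarrow> nat list \<Rightarrow> 'a set" where
  "basic_cube S K w = word_map S w ` K"

text \<open>Infinite words are 0-indexed, so the prefix \<open>i\<^sub>1 \<dots> i\<^sub>n\<close> of \<open>\<omega>\<close> is \<open>map \<omega> [0..<n]\<close>.\<close>

definition infinite_words :: "nat \<Rightarrow> (nat \<Rightarrow> nat) set" where
  "infinite_words m = {\<omega>. \<forall>k. \<omega> k \<in> {1..m}}"

definition coding_map :: "(nat \<Rightarrow> 'a \<Rightarrow> 'a) \<Rightarrow> 'a set \<Rightarrow> (nat \<Rightarrow> nat) \<Rightarrow> 'a" where
  "coding_map S K \<omega> = (THE x. {x} = (\<Inter>n\<in>{1..}. basic_cube S K (map \<omega> [0..<n])))"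

definition word_shift :: "(nat \<Rightarrow> nat) \<Rightarrow> nat \<Rightarrow> nat" where
  "word_shift \<omega> = (\<lambda>k. \<omega> (Suc k))"

definition critical_points :: "nat \<Rightarrow> (nat \<Rightarrow> 'a \<Rightarrow> 'a) \<Rightarrow> 'a set \<Rightarrow> 'a set" where
  "critical_points m S K = (\<Union>i\<in>{1..m}. \<Union>j\<in>{1..m} - {i}. S i ` K \<inter> S j ` K)"

definition critical_words :: "nat \<Rightarrow> (nat \<Rightarrow> 'a \<Rightarrow> 'a) \<Rightarrow> 'a set \<Rightarrow> (nat \<Rightarrow> nat) set" where
  "critical_words m S K = {\<omega> \<in> infinite_words m. coding_map S K \<omega> \<in> critical_points m S K}"

definition post_critically_finite :: "nat \<Rightarrow> (nat \<Rightarrow> 'a \<Rightarrow> 'a) \<Rightarrow> 'a set \<Rightarrow> bool" where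
  "post_critically_finite m S K \<longleftrightarrow>
     finite (\<Union>n\<in>{1..}. (word_shift ^^ n) ` critical_words m S K)"

definition locally_integrable_on ::
  "'a::euclidean_space set \<Rightarrow> 'a measure \<Rightarrow> ('a \<Rightarrow> real) \<Rightarrow> bool" where
  "locally_integrable_on K \<mu> f \<longleftrightarrow> (\<forall>C. compact C \<and> C \<subseteq> K \<longrightarrow> set_integrable \<mu> C f)"

text \<open>An admissible choice, for all \<open>n \<ge> 1\<close>, of a word \<open>w n\<close> of length \<open>n\<close> whose basic cube contains
  \<open>x\<close>. The cubes of different levels need not be nested.\<close>

definition basic_cube_choice ::
  "nat \<Rightarrow> (nat \<Rightarrow> 'a \<Rightarrow> 'a) \<Rightarrow> 'a set \<Rightarrow> 'a \<Rightarrow> (nat \<Rightarrow> nat list) \<Rightarrow> bool" where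
  "basic_cube_choice m S K x w \<longleftrightarrow> (\<forall>n\<ge>1. w n \<in> words m n \<and> x \<in> basic_cube S K (w n))"

end

theory Submission
  imports Defs "HOL-Library.Sublist"
begin

text \<open>
  The basic cubes behave like the dyadic cubes of Lebesgue's differentiation theorem, up to a null
  set, and the proof has two independent halves.

  \<^emph>\<open>Geometry.\<close> The union of the shifted images of \<open>\<C>\<close> is finite. A word is determined by its
  first letter and its shift, so \<open>\<C>\<close> itself is finite, and since every point of \<open>K\<close> has a code, so is
  the critical set (\<open>finite_critical_points\<close>). If neither of the words \<open>v\<close>, \<open>w\<close> is a prefix of the
  other, then they part after a common prefix \<open>u\<close>, and \<open>K\<^sub>v \<inter> K\<^sub>w\<close> lies in the image under \<open>S\<^sub>u\<close> of the
  critical set; so it is finite (\<open>finite_overlap\<close>). As the maps have no common fixed point, \<open>\<mu>\<close> has no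
  atoms (\<open>self_similar_measure_no_atoms\<close>), so these overlaps are null sets. Thus any two cubes
  are nested or meet in a null set.

  \<^emph>\<open>Measure theory.\<close> From any family of cubes keep those whose words have no proper
  prefix in the family: they have the same union and, by the first half, are disjoint up to a null
  set, so measures of unions are sums (\<open>covering_bound\<close>). Let \<open>g \<ge> 0\<close> be integrable and vanish
  on \<open>A\<close>. The measure \<open>g \<mu>\<close> gives \<open>A\<close> mass zero, so \<open>A\<close> has open neighbourhoods of arbitrarily
  small \<open>g \<mu>\<close>-mass. The cubes in such a neighbourhood on which the average of \<open>g\<close> exceeds a given
  \<open>\<epsilon>\<close> have a union of \<open>\<mu>\<close>-measure at most \<open>1 / \<epsilon>\<close> times that mass. Hence the averages of \<open>g\<close> tend
  to zero at almost every point of \<open>A\<close> (\<open>averages_vanish_on_zero_set\<close>). The general case follows by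
  taking for \<open>A\<close> the set where \<open>f\<close> is close to a rational number \<open>q\<close> and for \<open>g\<close> the function
  \<open>\<bar>f - q\<bar>\<close> off that set (\<open>ae_lebesgue_point\<close>).

  The differentiation statement speaks of all small cubes through \<open>x\<close> at once, so the cubes chosen
  at different levels may be arbitrary.
\<close>

section \<open>Differentiation along a tree of sets\<close>

lemma minimal_prefix:
  assumes "w \<in> V"
  obtains u where "u \<in> V" "prefix u w" "\<And>v. v \<in> V \<Longrightarrow> prefix v u \<Longrightarrow> v = u"
proof -
  let ?P = "\<lambda>u. u \<in> V \<and> prefix u w"
  have "?P w" using assms by simp
  then obtain u where u: "?P u" "\<And>v. ?P v \<Longrightarrow> length u \<le> length v"
    using arg_min_nat_lemma[of ?P w length] by blast
  show thesis
  proof (rule that)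
    fix v assume v: "v \<in> V" "prefix v u"
    then have "length u \<le> length v" using u prefix_order.trans by blast
    then show "v = u" using v(2)
      by (auto simp: prefix_def)
  qed (use u in auto)
qed

text \<open>
  Restricting to the words of \<open>V\<close> without a proper prefix in \<open>V\<close> leaves the union unchanged, because
  a longer word has a smaller set. Those words are pairwise incomparable, so up to a null set their
  sets are disjoint and the bounds can be added.
\<close>

lemma covering_bound:
  fixes Q :: "'b::countable list \<Rightarrow> 'a set"
  assumes sets [measurable]: "\<And>w. w \<in> V \<Longrightarrow> Q w \<in> sets M"
    and antimono: "\<And>u w. u \<in> V \<Longrightarrow> w \<in> V \<Longrightarrow> prefix u w \<Longrightarrow> Q w \<subseteq> Q u"
    and overlap: "\<And>u w. u \<in> V \<Longrightarrow> w \<in> V \<Longrightarrow> u \<parallel> w \<Longrightarrow> Q u \<inter> Q w \<in> null_sets M"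
    and U: "U \<in> sets M" "\<And>w. w \<in> V \<Longrightarrow> Q w \<subseteq> U"
    and g [measurable]: "g \<in> borel_measurable M"
    and large: "\<And>w. w \<in> V \<Longrightarrow> c * emeasure M (Q w) \<le> emeasure (density M g) (Q w)"
  shows "c * emeasure M (\<Union>w\<in>V. Q w) \<le> emeasure (density M g) U"
proof -
  define V' where "V' = {w \<in> V. \<forall>v\<in>V. prefix v w \<longrightarrow> v = w}"
  have V'V: "V' \<subseteq> V" by (auto simp: V'_def)
  have parallel: "u \<parallel> w" if "u \<in> V'" "w \<in> V'" "u \<noteq> w" for u w
    using that unfolding V'_def by (auto intro!: parallelI)
  \<comment> \<open>Without the countably many overlaps, the sets of minimal words are genuinely disjoint.\<close>
  define N where "N = (\<Union>u\<in>V'. \<Union>w\<in>V' - {u}. Q u \<inter> Q w)"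
  have N: "N \<in> null_sets M" unfolding N_def
    using V'V parallel overlap by (intro null_sets_UN') (auto, blast)
  have N': "N \<in> null_sets (density M g)"
    using N by (subst null_sets_density_iff) (auto dest: AE_not_in)
  have Nm [measurable]: "N \<in> sets M" using N by auto
  have cover: "(\<Union>w\<in>V. Q w) = (\<Union>w\<in>V'. Q w)"
  proof
    show "(\<Union>w\<in>V. Q w) \<subseteq> (\<Union>w\<in>V'. Q w)"
    proof
      fix x assume "x \<in> (\<Union>w\<in>V. Q w)"
      then obtain w where w: "w \<in> V" "x \<in> Q w" by auto
      from minimal_prefix[OF w(1)] obtain u
        where u: "u \<in> V" "prefix u w" "\<And>v. v \<in> V \<Longrightarrow> prefix v u \<Longrightarrow> v = u" by blast
      then have "u \<in> V'" by (auto simp: V'_def)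
      then show "x \<in> (\<Union>w\<in>V'. Q w)" using antimono[OF u(1) w(1) u(2)] w(2) by blast
    qed
  qed (use V'V in auto)
  have disj: "disjoint_family_on (\<lambda>w. Q w - N) V'"
    unfolding disjoint_family_on_def N_def by blast
  have sets': "Q w - N \<in> sets M" if "w \<in> V'" for w using V'V that by auto
  have "c * emeasure M (\<Union>w\<in>V. Q w) = c * emeasure M ((\<Union>w\<in>V'. Q w) - N)"
    unfolding cover using N V'V
    by (subst emeasure_Diff_null_set) (auto intro!: sets.countable_UN'' )
  also have "(\<Union>w\<in>V'. Q w) - N = (\<Union>w\<in>V'. Q w - N)" by auto
  also have "c * emeasure M (\<Union>w\<in>V'. Q w - N)
      = c * (\<integral>\<^sup>+w. emeasure M (Q w - N) \<partial>count_space V')"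
    using sets' disj by (subst emeasure_UN_countable) auto
  also have "\<dots> = (\<integral>\<^sup>+w. c * emeasure M (Q w - N) \<partial>count_space V')"
    by (simp add: nn_integral_cmult)
  also have "\<dots> \<le> (\<integral>\<^sup>+w. emeasure (density M g) (Q w - N) \<partial>count_space V')"
  proof (rule nn_integral_mono)
    fix w assume "w \<in> space (count_space V')"
    then have w: "w \<in> V" using V'V by auto
    have "emeasure M (Q w - N) = emeasure M (Q w)"
      using N w by (intro emeasure_Diff_null_set) auto
    moreover have "emeasure (density M g) (Q w - N) = emeasure (density M g) (Q w)"
      using N' w by (intro emeasure_Diff_null_set) auto
    ultimately show "c * emeasure M (Q w - N) \<le> emeasure (density M g) (Q w - N)"
      using large[OF w] by simp
  qed
  also have "\<dots> = emeasure (density M g) (\<Union>w\<in>V'. Q w - N)"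
    using sets' disj by (subst emeasure_UN_countable) auto
  also have "\<dots> \<le> emeasure (density M g) U"
    using U V'V by (intro emeasure_mono) auto
  finally show ?thesis .
qed

lemma emeasure_density_integral:
  fixes g :: "'a \<Rightarrow> real"
  assumes g: "integrable M g" "\<And>x. 0 \<le> g x" and A: "A \<in> sets M"
  shows "emeasure (density M (\<lambda>x. ennreal (g x))) A = ennreal (LINT x:A|M. g x)"
proof -
  have "emeasure (density M (\<lambda>x. ennreal (g x))) A
      = (\<integral>\<^sup>+x. ennreal (indicator A x * g x) \<partial>M)"
    using g A by (subst emeasure_density) (auto intro!: nn_integral_cong split: split_indicator)
  also have "\<dots> = ennreal (LINT x:A|M. g x)"
    unfolding set_lebesgue_integral_def using g A
    by (subst nn_integral_eq_integral)
       (auto intro!: integrable_real_mult_indicator simp: mult.commute)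
  finally show ?thesis .
qed

text \<open>
  Outer regularity of \<open>g M\<close> shrinks open neighbourhoods \<open>U n\<close> of \<open>A\<close> to mass zero. A point of \<open>A\<close> that
  lies in arbitrarily small sets of large average is, for every \<open>n\<close>, in such a set contained in
  \<open>U n\<close>; so all bad points lie in the null set \<open>Z\<close>.
\<close>

lemma averages_vanish_on_zero_set:
  fixes M :: "'a::{second_countable_topology, complete_space} measure"
    and Q :: "'b::countable list \<Rightarrow> 'a set" and g :: "'a \<Rightarrow> real"
  assumes "finite_measure M" and borel: "sets M = sets borel"
    and sets: "\<And>w. w \<in> W \<Longrightarrow> Q w \<in> sets M"
    and antimono: "\<And>u w. u \<in> W \<Longrightarrow> w \<in> W \<Longrightarrow> prefix u w \<Longrightarrow> Q w \<subseteq> Q u"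
    and overlap: "\<And>u w. u \<in> W \<Longrightarrow> w \<in> W \<Longrightarrow> u \<parallel> w \<Longrightarrow> Q u \<inter> Q w \<in> null_sets M"
    and g: "integrable M g" "\<And>x. 0 \<le> g x"
    and A: "A \<in> sets M" "\<And>x. x \<in> A \<Longrightarrow> g x = 0" and "0 < \<epsilon>"
  shows "AE x in M. x \<in> A \<longrightarrow> (\<exists>\<delta>>0. \<forall>w\<in>W. x \<in> Q w \<longrightarrow> Q w \<subseteq> ball x \<delta> \<longrightarrow>
           (LINT y:Q w|M. g y) \<le> \<epsilon> * measure M (Q w))"
proof -
  interpret finite_measure M by fact
  define \<nu> where "\<nu> = density M (\<lambda>x. ennreal (g x))"
  have \<nu>: "emeasure \<nu> B = ennreal (LINT x:B|M. g x)" if "B \<in> sets M" for B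
    unfolding \<nu>_def using emeasure_density_integral[OF g that] .
  have \<nu>_sets: "sets \<nu> = sets borel" by (simp add: \<nu>_def borel)
  have "emeasure \<nu> (space \<nu>) \<noteq> \<infinity>" using \<nu>[of "space M"] by (simp add: \<nu>_def)
  then have "emeasure \<nu> A = (INF U\<in>{U. A \<subseteq> U \<and> open U}. emeasure \<nu> U)"
    using \<nu>_sets A(1) borel by (intro outer_regular) auto
  moreover have "emeasure \<nu> A = 0"
  proof -
    have "(LINT x:A|M. g x) = 0"
      unfolding set_lebesgue_integral_def
      by (rule integral_eq_zero_AE) (auto simp: A(2) split: split_indicator)
    then show ?thesis using \<nu>[OF A(1)] by simp
  qed
  ultimately have INF0: "(INF U\<in>{U. A \<subseteq> U \<and> open U}. emeasure \<nu> U) = 0" by simp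
  have "\<exists>U. A \<subseteq> U \<and> open U \<and> emeasure \<nu> U < ennreal (1 / real (Suc n))" for n
  proof -
    have "(INF U\<in>{U. A \<subseteq> U \<and> open U}. emeasure \<nu> U) < ennreal (1 / real (Suc n))"
      unfolding INF0 by simp
    then show ?thesis unfolding INF_less_iff by auto
  qed
  then obtain U where U: "\<And>n. A \<subseteq> U n" "\<And>n. open (U n)"
      "\<And>n. emeasure \<nu> (U n) < ennreal (1 / real (Suc n))" by metis
  define V where "V n = {w \<in> W. Q w \<subseteq> U n \<and> \<epsilon> * measure M (Q w) < (LINT y:Q w|M. g y)}" for n
  define G where "G n = (\<Union>w\<in>V n. Q w)" for n
  have G_sets: "G n \<in> sets M" for n
    unfolding G_def using sets by (intro sets.countable_UN'') (auto simp: V_def)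
  have G_small: "\<epsilon> * measure M (G n) \<le> 1 / real (Suc n)" for n
  proof -
    have "ennreal \<epsilon> * emeasure M (G n) \<le> emeasure \<nu> (U n)"
      unfolding G_def \<nu>_def
    proof (rule covering_bound)
      fix w assume w: "w \<in> V n"
      then have "w \<in> W" by (simp add: V_def)
      have "ennreal \<epsilon> * emeasure M (Q w) = ennreal (\<epsilon> * measure M (Q w))"
        using \<open>0 < \<epsilon>\<close> by (simp add: emeasure_eq_measure ennreal_mult)
      also have "\<dots> \<le> emeasure \<nu> (Q w)"
        using w \<nu>[OF sets[OF \<open>w \<in> W\<close>]] by (auto simp: V_def intro!: ennreal_leI)
      finally show "ennreal \<epsilon> * emeasure M (Q w)
          \<le> emeasure (density M (\<lambda>x. ennreal (g x))) (Q w)" unfolding \<nu>_def .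
    qed (use sets antimono overlap U borel g in \<open>auto simp: V_def\<close>)
    also have "\<dots> \<le> ennreal (1 / real (Suc n))" using U(3) by (simp add: less_imp_le)
    finally have "ennreal (\<epsilon> * measure M (G n)) \<le> ennreal (1 / real (Suc n))"
      using \<open>0 < \<epsilon>\<close> by (simp add: emeasure_eq_measure ennreal_mult)
    then show ?thesis by (subst (asm) ennreal_le_iff) auto
  qed
  define Z where "Z = (\<Inter>n. G n)"
  have Z_sets: "Z \<in> sets M" unfolding Z_def using G_sets by auto
  have "measure M Z = 0"
  proof (rule ccontr)
    assume "measure M Z \<noteq> 0"
    then have "0 < \<epsilon> * measure M Z" using \<open>0 < \<epsilon>\<close> by (simp add: zero_less_measure_iff)
    then obtain n where n: "inverse (real (Suc n)) < \<epsilon> * measure M Z"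
      using reals_Archimedean by blast
    have "measure M Z \<le> measure M (G n)"
      using G_sets by (intro finite_measure_mono) (auto simp: Z_def)
    then have "\<epsilon> * measure M Z \<le> \<epsilon> * measure M (G n)" using \<open>0 < \<epsilon>\<close> by simp
    then show False using n G_small[of n] by (simp add: inverse_eq_divide)
  qed
  then have "Z \<in> null_sets M" using Z_sets by (simp add: emeasure_eq_measure null_setsI)
  then have "AE x in M. x \<notin> Z" by (rule AE_not_in)
  then show ?thesis
  proof (rule AE_mp, intro AE_I2 impI)
    fix x assume "x \<notin> Z" "x \<in> A"
    then obtain n where n: "x \<notin> G n" by (auto simp: Z_def)
    have "x \<in> U n" using U(1) \<open>x \<in> A\<close> by blast
    then obtain \<delta> where "0 < \<delta>" "ball x \<delta> \<subseteq> U n" using U(2) open_contains_ball by metis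
    moreover have "(LINT y:Q w|M. g y) \<le> \<epsilon> * measure M (Q w)"
      if "w \<in> W" "x \<in> Q w" "Q w \<subseteq> ball x \<delta>" for w
      using that n \<open>ball x \<delta> \<subseteq> U n\<close> unfolding G_def V_def by force
    ultimately show "\<exists>\<delta>>0. \<forall>w\<in>W. x \<in> Q w \<longrightarrow> Q w \<subseteq> ball x \<delta> \<longrightarrow>
           (LINT y:Q w|M. g y) \<le> \<epsilon> * measure M (Q w)" by blast
  qed
qed

text \<open>
  Let \<open>\<bar>f x - q\<bar> < \<eta>\<close>. Then \<open>\<bar>f y - f x\<bar> \<le> \<bar>f y - q\<bar> + \<eta>\<close>, and \<open>\<bar>f y - q\<bar>\<close> is itself below \<open>\<eta>\<close>
  unless \<open>y\<close> lies outside \<open>{\<bar>f - q\<bar> < \<eta>}\<close>. The excess is the function \<open>g\<close> below, which vanishes on a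
  set containing \<open>x\<close>. Rational \<open>q\<close> and \<open>\<eta> = 1 / (k + 1)\<close> suffice, so only countably many null sets
  are discarded.
\<close>

lemma ae_lebesgue_point:
  fixes M :: "'a::{second_countable_topology, complete_space} measure"
    and Q :: "'b::countable list \<Rightarrow> 'a set" and f :: "'a \<Rightarrow> real"
  assumes "finite_measure M" and borel: "sets M = sets borel"
    and sets: "\<And>w. w \<in> W \<Longrightarrow> Q w \<in> sets M"
    and antimono: "\<And>u w. u \<in> W \<Longrightarrow> w \<in> W \<Longrightarrow> prefix u w \<Longrightarrow> Q w \<subseteq> Q u"
    and overlap: "\<And>u w. u \<in> W \<Longrightarrow> w \<in> W \<Longrightarrow> u \<parallel> w \<Longrightarrow> Q u \<inter> Q w \<in> null_sets M"
    and f: "integrable M f"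
  shows "AE x in M. \<forall>\<epsilon>>0. \<exists>\<delta>>0. \<forall>w\<in>W. x \<in> Q w \<longrightarrow> Q w \<subseteq> ball x \<delta> \<longrightarrow>
           (LINT y:Q w|M. \<bar>f y - f x\<bar>) \<le> \<epsilon> * measure M (Q w)"
proof -
  interpret finite_measure M by fact
  have [measurable]: "f \<in> borel_measurable M" using f by auto
  define E where "E k = 1 / real (Suc k)" for k
  have E: "0 < E k" for k by (simp add: E_def)
  define A where "A q k = {x \<in> space M. \<bar>f x - of_rat q\<bar> < E k}" for q k
  define g where "g q k y = indicator (- A q k) y * \<bar>f y - of_rat q\<bar>" for q k y
  have A_sets [measurable]: "A q k \<in> sets M" for q k unfolding A_def by measurable
  have A_compl: "- A q k \<in> sets M" for q k
    using borel A_sets[of q k] by (metis borel_comp)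
  have g_int: "integrable M (g q k)" for q k
    unfolding g_def using A_compl f
    by (subst mult.commute) (intro integrable_real_mult_indicator integrable_abs Bochner_Integration.integrable_diff, auto)
  have "AE x in M. \<forall>q k. x \<in> A q k \<longrightarrow> (\<exists>\<delta>>0. \<forall>w\<in>W. x \<in> Q w \<longrightarrow> Q w \<subseteq> ball x \<delta> \<longrightarrow>
           (LINT y:Q w|M. g q k y) \<le> E k * measure M (Q w))"
  proof (simp only: AE_all_countable, intro allI)
    fix q k
    show "AE x in M. x \<in> A q k \<longrightarrow> (\<exists>\<delta>>0. \<forall>w\<in>W. x \<in> Q w \<longrightarrow> Q w \<subseteq> ball x \<delta> \<longrightarrow>
           (LINT y:Q w|M. g q k y) \<le> E k * measure M (Q w))"
      by (rule averages_vanish_on_zero_set[OF assms(1-5) g_int])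
         (auto simp: E g_def sets antimono)
  qed
  then show ?thesis
  proof (rule AE_mp, intro AE_I2 impI allI)
    fix x :: 'a and \<epsilon> :: real
    assume x: "x \<in> space M" and
      *: "\<forall>q k. x \<in> A q k \<longrightarrow> (\<exists>\<delta>>0. \<forall>w\<in>W. x \<in> Q w \<longrightarrow> Q w \<subseteq> ball x \<delta> \<longrightarrow>
           (LINT y:Q w|M. g q k y) \<le> E k * measure M (Q w))" and "0 < \<epsilon>"
    \<comment> \<open>One third each for the average of \<open>g\<close>, for \<open>\<bar>f y - q\<bar>\<close> near \<open>q\<close>, and for \<open>\<bar>q - f x\<bar>\<close>.\<close>
    from \<open>0 < \<epsilon>\<close> obtain k where k: "inverse (real (Suc k)) < \<epsilon> / 3"
      using reals_Archimedean[of "\<epsilon>/3"] by auto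
    obtain q where q: "f x - E k < of_rat q" "of_rat q < f x + E k"
      using of_rat_dense[of "f x - E k" "f x + E k"] E[of k] by auto
    have "x \<in> A q k" using x q by (auto simp: A_def)
    with * obtain \<delta> where \<delta>: "0 < \<delta>" "\<And>w. w \<in> W \<Longrightarrow> x \<in> Q w \<Longrightarrow> Q w \<subseteq> ball x \<delta> \<Longrightarrow>
           (LINT y:Q w|M. g q k y) \<le> E k * measure M (Q w)" by metis
    have "(LINT y:Q w|M. \<bar>f y - f x\<bar>) \<le> \<epsilon> * measure M (Q w)"
      if w: "w \<in> W" "x \<in> Q w" "Q w \<subseteq> ball x \<delta>" for w
    proof -
      have Qw [measurable]: "Q w \<in> sets M" using sets w by auto
      have si: "set_integrable M (Q w) h" if "integrable M h" for h :: "'a \<Rightarrow> real"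
        using integrable_real_mult_indicator[OF Qw that]
        by (simp add: set_integrable_def mult.commute)
      have "(LINT y:Q w|M. \<bar>f y - f x\<bar>) \<le> (LINT y:Q w|M. g q k y + 2 * E k)"
      proof (rule set_integral_mono)
        show "set_integrable M (Q w) (\<lambda>y. \<bar>f y - f x\<bar>)"
          by (intro si integrable_abs Bochner_Integration.integrable_diff f) auto
        show "set_integrable M (Q w) (\<lambda>y. g q k y + 2 * E k)"
          by (intro si Bochner_Integration.integrable_add g_int) auto
        fix y assume "y \<in> Q w"
        then have "y \<in> space M" using sets.sets_into_space[OF Qw] by auto
        then have "\<bar>f y - of_rat q\<bar> \<le> g q k y + E k"
          using E[of k] by (auto simp: g_def A_def split: split_indicator)
        then show "\<bar>f y - f x\<bar> \<le> g q k y + 2 * E k" using q by linarith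
      qed
      also have "\<dots> = (LINT y:Q w|M. g q k y) + 2 * E k * measure M (Q w)"
        using si[OF g_int] si[of "\<lambda>_. 2 * E k"] Qw
        by (subst set_integral_add) (auto simp: set_lebesgue_integral_def mult.commute)
      also have "\<dots> \<le> 3 * E k * measure M (Q w)" using \<delta>(2)[OF w] by simp
      also have "\<dots> \<le> \<epsilon> * measure M (Q w)"
        using k by (intro mult_right_mono) (auto simp: E_def inverse_eq_divide)
      finally show ?thesis .
    qed
    then show "\<exists>\<delta>>0. \<forall>w\<in>W. x \<in> Q w \<longrightarrow> Q w \<subseteq> ball x \<delta> \<longrightarrow>
           (LINT y:Q w|M. \<bar>f y - f x\<bar>) \<le> \<epsilon> * measure M (Q w)" using \<delta>(1) by blast
  qed
qed

section \<open>Self-similar measures have no atoms\<close>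

lemma contracting_similarity_ratio:
  assumes "contracting_similarity T"
  obtains r where "0 < r" "r < 1" "\<And>x y. dist (T x) (T y) = r * dist x y"
proof -
  obtain r R b where r: "0 < r" "r < 1" and R: "orthogonal_transformation R"
    and T: "T = (\<lambda>x. r *\<^sub>R R x + b)"
    using assms unfolding contracting_similarity_def by blast
  have "dist (T x) (T y) = r * dist x y" for x y
  proof -
    have "dist (T x) (T y) = norm (r *\<^sub>R (R x - R y))"
      by (simp add: T dist_norm algebra_simps)
    also have "\<dots> = r * dist (R x) (R y)" using r by (simp add: dist_norm)
    also have "dist (R x) (R y) = dist x y" using R by (simp add: orthogonal_transformation_isometry)
    finally show ?thesis .
  qed
  with r show thesis by (rule that)
qed

lemma contracting_similarity_inj: "contracting_similarity T \<Longrightarrow> inj T"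
  by (erule contracting_similarity_ratio) (auto intro!: injI, metis dist_eq_0_iff less_irrefl mult_eq_0_iff)

lemma contracting_similarity_continuous:
  assumes "contracting_similarity T"
  shows "continuous_on A T"
proof -
  obtain r where "0 < r" "\<And>x y. dist (T x) (T y) = r * dist x y"
    using contracting_similarity_ratio[OF assms] by metis
  then have "r-lipschitz_on A T" by (intro lipschitz_onI) auto
  then show ?thesis by (rule lipschitz_on_continuous_on)
qed

text \<open>
  Take two points of \<open>T\<close> at maximal distance: preimages of them in \<open>T\<close> would be even further apart.
\<close>

lemma contracting_preimages_subset_singleton:
  fixes T :: "'a::metric_space set"
  assumes "finite T" and "0 < r" "r < 1" and "\<And>x y. dist (s x) (s y) = r * dist x y"
    and "T \<subseteq> s ` T" "x \<in> T" "y \<in> T"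
  shows "x = y"
proof (rule ccontr)
  assume "x \<noteq> y"
  define D where "D = Max ((\<lambda>(x, y). dist x y) ` (T \<times> T))"
  have fin: "finite ((\<lambda>(x, y). dist x y) ` (T \<times> T))" using \<open>finite T\<close> by simp
  have D: "dist a b \<le> D" if "a \<in> T" "b \<in> T" for a b
    unfolding D_def by (rule Max_ge[OF fin]) (use that in force)
  have "D \<in> (\<lambda>(x, y). dist x y) ` (T \<times> T)"
    unfolding D_def by (rule Max_in[OF fin]) (use assms(6) in auto)
  then obtain a b where ab: "a \<in> T" "b \<in> T" "dist a b = D" by auto
  have "0 < D" using D[OF assms(6,7)] \<open>x \<noteq> y\<close> by (meson dist_pos_lt less_le_trans)
  obtain a' b' where "a' \<in> T" "b' \<in> T" "a = s a'" "b = s b'" using assms(5) ab by blast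
  then have "D \<le> r * D" using D[of a' b'] ab assms(2,4) by (metis mult_le_cancel_left_pos)
  then show False using \<open>0 < D\<close> \<open>r < 1\<close> by (simp add: mult_le_cancel_right1)
qed

text \<open>
  In a probability space at most \<open>1 / b\<close> points have mass \<open>b\<close> or more, so the supremum of the masses
  of points is attained, at finitely many points only.
\<close>

lemma heaviest_atoms:
  assumes "prob_space \<mu>" and sets: "\<And>x. {x} \<in> sets \<mu>" and "0 < measure \<mu> {x\<^sub>0}"
  obtains T c where "finite T" "T \<noteq> {}" "T = {x. measure \<mu> {x} = c}" "0 < c"
    "\<And>x. measure \<mu> {x} \<le> c"
proof -
  interpret prob_space \<mu> by fact
  define b where "b = measure \<mu> {x\<^sub>0}"
  define B where "B = {x. b \<le> measure \<mu> {x}}"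
  have "x\<^sub>0 \<in> B" by (simp add: B_def b_def)
  have "0 < b" using assms by (simp add: b_def)
  have "finite B"
  proof (rule ccontr)
    assume "infinite B"
    obtain n where n: "1 < real n * b" using \<open>0 < b\<close> by (metis ex_less_of_nat_mult)
    obtain F where F: "F \<subseteq> B" "finite F" "card F = n"
      using infinite_arbitrarily_large[OF \<open>infinite B\<close>] by blast
    have "real n * b \<le> (\<Sum>x\<in>F. measure \<mu> {x})"
      using F sum_bounded_below[of F b "\<lambda>x. measure \<mu> {x}"] by (auto simp: B_def)
    also have "\<dots> = measure \<mu> F"
      using F(2) sets by (intro finite_measure_eq_sum_singleton[symmetric]) auto
    also have "\<dots> \<le> 1" by simp
    finally show False using n by simp
  qed
  define c where "c = Max ((\<lambda>x. measure \<mu> {x}) ` B)"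
  have fin: "finite ((\<lambda>x. measure \<mu> {x}) ` B)" using \<open>finite B\<close> by simp
  have c_ge: "measure \<mu> {x} \<le> c" if "x \<in> B" for x
    unfolding c_def using fin that by (intro Max_ge) auto
  have "b \<le> c" using c_ge[OF \<open>x\<^sub>0 \<in> B\<close>] by (simp add: b_def)
  show thesis
  proof (rule that)
    show "{x. measure \<mu> {x} = c} = {x. measure \<mu> {x} = c}" ..
    show "finite {x. measure \<mu> {x} = c}"
      using \<open>finite B\<close> \<open>b \<le> c\<close> by (rule_tac finite_subset[of _ B]) (auto simp: B_def)
    have "c \<in> (\<lambda>x. measure \<mu> {x}) ` B"
      unfolding c_def using \<open>x\<^sub>0 \<in> B\<close> by (intro Max_in[OF fin]) auto
    then show "{x. measure \<mu> {x} = c} \<noteq> {}" by auto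
    show "0 < c" using \<open>0 < b\<close> \<open>b \<le> c\<close> by simp
    show "measure \<mu> {x} \<le> c" for x
      using c_ge[of x] \<open>b \<le> c\<close> by (cases "x \<in> B") (auto simp: B_def)
  qed
qed

text \<open>
  Let \<open>T\<close> be the finite set of heaviest atoms. The mass of \<open>y \<in> T\<close> is the weighted mean of the
  masses of its preimages under the maps \<open>S i\<close>, none of which exceeds it; so under every \<open>S i\<close> the
  point \<open>y\<close> has a preimage in \<open>T\<close>. For a contraction this forces \<open>T\<close> to be a single point, which all
  \<open>S i\<close> then fix.
\<close>

lemma self_similar_measure_no_atoms:
  fixes \<mu> :: "'a::euclidean_space measure"
  assumes contr: "\<forall>i\<in>{1..m}. contracting_similarity (S i)"
    and no_fix: "\<not> (\<exists>x. \<forall>i\<in>{1..m}. S i x = x)"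
    and p: "probability_vector m p" and \<mu>: "self_similar_measure m S p \<mu>"
  shows "measure \<mu> {x} = 0"
proof (rule ccontr)
  assume "measure \<mu> {x} \<noteq> 0"
  then have pos: "0 < measure \<mu> {x}" by (simp add: zero_less_measure_iff)
  have ps: "prob_space \<mu>" and sets: "sets \<mu> = sets borel" and
    inv: "\<And>A. A \<in> sets borel \<Longrightarrow> measure \<mu> A = (\<Sum>i\<in>{1..m}. p i * measure \<mu> (S i -` A))"
    using \<mu> by (auto simp: self_similar_measure_def)
  from heaviest_atoms[OF ps _ pos] sets obtain T c where T: "finite T" "T \<noteq> {}"
      "T = {x. measure \<mu> {x} = c}" "0 < c" "\<And>x. measure \<mu> {x} \<le> c"
    by (metis borel_singleton sets.empty_sets)
  have preimage_mass: "measure \<mu> (S i -` {y}) \<le> c" if "i \<in> {1..m}" for i y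
  proof (cases "S i -` {y} = {}")
    case False
    then obtain z where "S i z = y" by auto
    moreover have "inj (S i)" using contr that contracting_similarity_inj by blast
    ultimately have "S i -` {y} = {z}" by (auto dest: injD)
    then show ?thesis using T(5) by simp
  qed (use T(4) in simp)
  have surj: "T \<subseteq> S i ` T" if i: "i \<in> {1..m}" for i
  proof
    fix y assume "y \<in> T"
    have "measure \<mu> (S i -` {y}) = c"
    proof (rule ccontr)
      assume "measure \<mu> (S i -` {y}) \<noteq> c"
      then have "measure \<mu> (S i -` {y}) < c" using preimage_mass[OF i, of y] by simp
      then have "(\<Sum>j\<in>{1..m}. p j * measure \<mu> (S j -` {y})) < (\<Sum>j\<in>{1..m}. p j * c)"
        using p preimage_mass i unfolding probability_vector_def
        by (intro sum_strict_mono_ex1) (auto intro!: mult_left_mono less_imp_le bexI[of _ i])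
      also have "\<dots> = c" using p by (simp add: probability_vector_def flip: sum_distrib_right)
      finally show False using inv[of "{y}"] \<open>y \<in> T\<close> T(3) by simp
    qed
    then have "S i -` {y} \<noteq> {}" using T(4) by auto
    then obtain z where z: "S i z = y" by auto
    moreover have "inj (S i)" using contr i contracting_similarity_inj by blast
    ultimately have "S i -` {y} = {z}" by (auto dest: injD)
    then have "z \<in> T" using \<open>measure \<mu> (S i -` {y}) = c\<close> T(3) by simp
    then show "y \<in> S i ` T" using z by auto
  qed
  obtain t where "t \<in> T" using T(2) by auto
  have "S i t = t" if i: "i \<in> {1..m}" for i
  proof -
    obtain r where "0 < r" "r < 1" "\<And>x y. dist (S i x) (S i y) = r * dist x y"
      using contracting_similarity_ratio contr i by metis
    then have single: "a = b" if "a \<in> T" "b \<in> T" for a b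
      using contracting_preimages_subset_singleton[OF T(1)] surj[OF i] that by metis
    obtain z where "z \<in> T" "t = S i z" using surj[OF i] \<open>t \<in> T\<close> by blast
    then show ?thesis using single[OF \<open>t \<in> T\<close> \<open>z \<in> T\<close>] by simp
  qed
  then show False using no_fix by blast
qed

section \<open>Basic cubes and their overlaps\<close>

lemma word_map_Nil [simp]: "word_map S [] = id"
  and word_map_Cons: "word_map S (i # w) = S i \<circ> word_map S w"
  by (simp_all add: word_map_def)

lemma word_map_append: "word_map S (u @ v) = word_map S u \<circ> word_map S v"
  by (induction u) (simp_all add: word_map_Cons comp_assoc)

lemma basic_cube_append: "basic_cube S K (u @ v) = word_map S u ` basic_cube S K v"
  by (simp add: basic_cube_def word_map_append image_comp)

locale similarity_system =
  fixes m :: nat and S :: "nat \<Rightarrow> 'a::euclidean_space \<Rightarrow> 'a" and K :: "'a set"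
  assumes contr: "\<And>i. i \<in> {1..m} \<Longrightarrow> contracting_similarity (S i)"
    and invariant: "self_similar_set m S K"
begin

lemma K_compact: "compact K" and K_eq: "K = (\<Union>i\<in>{1..m}. S i ` K)"
  using invariant by (auto simp: self_similar_set_def)

lemma word_map_inj: "set w \<subseteq> {1..m} \<Longrightarrow> inj (word_map S w)"
proof (induction w)
  case (Cons i w)
  then have "inj (S i)" using contr contracting_similarity_inj by auto
  with Cons show ?case unfolding word_map_Cons by (intro inj_compose) auto
qed simp

lemma word_map_continuous: "set w \<subseteq> {1..m} \<Longrightarrow> continuous_on A (word_map S w)"
proof (induction w)
  case (Cons i w)
  then have "continuous_on B (S i)" for B using contr contracting_similarity_continuous by auto
  with Cons show ?case unfolding word_map_Cons by (intro continuous_on_compose) auto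
qed simp

lemma basic_cube_compact: "set w \<subseteq> {1..m} \<Longrightarrow> compact (basic_cube S K w)"
  unfolding basic_cube_def by (intro compact_continuous_image word_map_continuous K_compact)

lemma basic_cube_subset: "set w \<subseteq> {1..m} \<Longrightarrow> basic_cube S K w \<subseteq> K"
proof (induction w)
  case (Cons i w)
  then have "basic_cube S K (i # w) \<subseteq> S i ` K"
    using basic_cube_append[of S K "[i]" w] by (auto simp: word_map_Cons)
  moreover have "S i ` K \<subseteq> K" using Cons.prems by (subst (2) K_eq) auto
  ultimately show ?case by blast
qed (simp add: basic_cube_def)

lemma basic_cube_antimono:
  assumes "set w \<subseteq> {1..m}" "prefix u w"
  shows "basic_cube S K w \<subseteq> basic_cube S K u"
proof -
  obtain v where w: "w = u @ v" using assms(2) by (auto simp: prefix_def)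
  then have "basic_cube S K v \<subseteq> K" using assms(1) by (intro basic_cube_subset) auto
  then show ?thesis unfolding w basic_cube_append by (auto simp: basic_cube_def)
qed

lemma uniform_ratio:
  obtains \<rho> where "0 \<le> \<rho>" "\<rho> < 1"
    "\<And>i x y. i \<in> {1..m} \<Longrightarrow> dist (S i x) (S i y) \<le> \<rho> * dist x y"
proof -
  have "\<forall>i\<in>{1..m}. \<exists>r. 0 < r \<and> r < 1 \<and> (\<forall>x y. dist (S i x) (S i y) = r * dist x y)"
    using contr contracting_similarity_ratio by metis
  then obtain r where r: "\<And>i. i \<in> {1..m} \<Longrightarrow> 0 < r i \<and> r i < 1"
      "\<And>i x y. i \<in> {1..m} \<Longrightarrow> dist (S i x) (S i y) = r i * dist x y" by metis
  \<comment> \<open>The inserted \<open>0\<close> makes the maximum exist, and be nonnegative, even when \<open>m = 0\<close>.\<close>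
  show thesis
  proof (rule that)
    show "0 \<le> Max (insert 0 (r ` {1..m}))" by (intro Max_ge) auto
    show "Max (insert 0 (r ` {1..m})) < 1" using r(1) by auto
    show "dist (S i x) (S i y) \<le> Max (insert 0 (r ` {1..m})) * dist x y" if "i \<in> {1..m}" for i x y
      unfolding r(2)[OF that] using that by (intro mult_right_mono Max_ge) auto
  qed
qed

lemma basic_cubes_shrink:
  assumes "0 < \<delta>"
  obtains N where "\<And>w x y. set w \<subseteq> {1..m} \<Longrightarrow> N \<le> length w \<Longrightarrow>
    x \<in> basic_cube S K w \<Longrightarrow> y \<in> basic_cube S K w \<Longrightarrow> dist x y < \<delta>"
proof -
  obtain \<rho> where \<rho>: "0 \<le> \<rho>" "\<rho> < 1"
    "\<And>i x y. i \<in> {1..m} \<Longrightarrow> dist (S i x) (S i y) \<le> \<rho> * dist x y" by (rule uniform_ratio) blast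
  have word: "dist (word_map S w x) (word_map S w y) \<le> \<rho> ^ length w * dist x y"
    if "set w \<subseteq> {1..m}" for w x y
    using that
  proof (induction w)
    case (Cons i w)
    have "dist (word_map S (i # w) x) (word_map S (i # w) y)
        \<le> \<rho> * dist (word_map S w x) (word_map S w y)"
      using Cons.prems \<rho>(3) by (simp add: word_map_Cons)
    also have "\<dots> \<le> \<rho> * (\<rho> ^ length w * dist x y)"
      using Cons \<rho>(1) by (intro mult_left_mono) auto
    finally show ?case by (simp add: mult.assoc)
  qed simp
  have "(\<lambda>n. \<rho> ^ n * diameter K) \<longlonglongrightarrow> 0 * diameter K"
    using \<rho> by (intro tendsto_intros LIMSEQ_realpow_zero) auto
  then have "\<forall>\<^sub>F n in sequentially. \<rho> ^ n * diameter K < \<delta>"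
    using \<open>0 < \<delta>\<close> by (auto dest: order_tendstoD(2))
  then obtain N where N: "\<And>n. N \<le> n \<Longrightarrow> \<rho> ^ n * diameter K < \<delta>"
    by (auto simp: eventually_sequentially)
  show thesis
  proof (rule that)
    fix w x y assume w: "set w \<subseteq> {1..m}" "N \<le> length w"
      and "x \<in> basic_cube S K w" "y \<in> basic_cube S K w"
    then obtain a b where ab: "a \<in> K" "b \<in> K" "x = word_map S w a" "y = word_map S w b"
      by (auto simp: basic_cube_def)
    have "dist x y \<le> \<rho> ^ length w * dist a b" using word[OF w(1)] ab by simp
    also have "\<dots> \<le> \<rho> ^ length w * diameter K"
      using ab \<rho>(1) K_compact
      by (intro mult_left_mono diameter_bounded_bound compact_imp_bounded) auto
    also have "\<dots> < \<delta>" using N w(2) by simp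
    finally show "dist x y < \<delta>" .
  qed
qed

text \<open>
  Every \<open>x \<in> K\<close> is \<open>S (a x) (b x)\<close> for some letter \<open>a x\<close> and some \<open>b x \<in> K\<close>; the letters along the orbit
  of \<open>x\<close> under \<open>b\<close> form a code. As the cubes shrink, \<open>x\<close> is the only point with that code, so the
  description in \<open>coding_map\<close> denotes it.
\<close>

lemma every_point_coded:
  assumes "x \<in> K"
  obtains \<omega> where "\<omega> \<in> infinite_words m" "coding_map S K \<omega> = x"
proof -
  have "\<forall>x\<in>K. \<exists>i y. i \<in> {1..m} \<and> y \<in> K \<and> x = S i y" using K_eq by blast
  then obtain a b where ab: "\<And>x. x \<in> K \<Longrightarrow> a x \<in> {1..m} \<and> b x \<in> K \<and> x = S (a x) (b x)"
    by metis
  define \<omega> where "\<omega> k = a ((b ^^ k) x)" for k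
  have orbit: "(b ^^ k) x \<in> K" for k by (induction k) (use assms ab in auto)
  have \<omega>: "\<omega> k \<in> {1..m}" for k using ab orbit by (simp add: \<omega>_def)
  have x_eq: "x = word_map S (map \<omega> [0..<n]) ((b ^^ n) x)" for n
  proof (induction n)
    case (Suc n)
    have "(b ^^ n) x = S (\<omega> n) ((b ^^ Suc n) x)"
      using ab[OF orbit[of n]] by (simp add: \<omega>_def)
    then show ?case using Suc by (simp add: word_map_append word_map_Cons)
  qed simp
  then have x_in: "x \<in> basic_cube S K (map \<omega> [0..<n])" for n
    unfolding basic_cube_def using orbit by blast
  have "{x} = (\<Inter>n\<in>{1..}. basic_cube S K (map \<omega> [0..<n]))"
  proof (intro equalityI subsetI)
    fix y assume y: "y \<in> (\<Inter>n\<in>{1..}. basic_cube S K (map \<omega> [0..<n]))"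
    show "y \<in> {x}"
    proof (rule ccontr)
      assume "y \<notin> {x}"
      then have "0 < dist x y" by auto
      then obtain N where N: "\<And>w u v. set w \<subseteq> {1..m} \<Longrightarrow> N \<le> length w \<Longrightarrow>
        u \<in> basic_cube S K w \<Longrightarrow> v \<in> basic_cube S K w \<Longrightarrow> dist u v < dist x y"
        by (rule basic_cubes_shrink) blast
      have "dist x y < dist x y"
      proof (rule N)
        show "x \<in> basic_cube S K (map \<omega> [0..<Suc N])" by (rule x_in)
        show "y \<in> basic_cube S K (map \<omega> [0..<Suc N])"
          by (rule INT_D[OF y]) simp
      qed (use \<omega> in auto)
      then show False by simp
    qed
  qed (use x_in in auto)
  then have "coding_map S K \<omega> = x" unfolding coding_map_def by (auto intro!: the_equality)
  then show thesis using that \<omega> by (auto simp: infinite_words_def)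
qed

text \<open>
  Post-critical finiteness speaks only of proper shifts of critical words, but the first shift
  together with the first of the \<open>m\<close> letters already determines the word.
\<close>

lemma finite_critical_points:
  assumes "post_critically_finite m S K"
  shows "finite (critical_points m S K)"
proof -
  define P where "P = (\<Union>n\<in>{1..}. (word_shift ^^ n) ` critical_words m S K)"
  have "finite P" using assms by (simp add: P_def post_critically_finite_def)
  define h where "h \<omega> = (\<omega> 0, word_shift \<omega>)" for \<omega> :: "nat \<Rightarrow> nat"
  have "inj h"
  proof (rule injI, rule ext)
    fix \<omega> \<omega>' k assume "h \<omega> = h \<omega>'"
    then show "\<omega> k = \<omega>' k" by (cases k) (auto simp: h_def word_shift_def fun_eq_iff)
  qed
  have "word_shift \<omega> \<in> P" if "\<omega> \<in> critical_words m S K" for \<omega>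
    unfolding P_def using that by (intro UN_I[of 1]) auto
  then have "h ` critical_words m S K \<subseteq> {1..m} \<times> P"
    by (auto simp: h_def critical_words_def infinite_words_def)
  then have "finite (h ` critical_words m S K)"
    using \<open>finite P\<close> by (meson finite_SigmaI finite_atLeastAtMost finite_subset)
  then have "finite (critical_words m S K)"
    using \<open>inj h\<close> by (meson finite_imageD inj_on_subset subset_UNIV)
  moreover have "critical_points m S K \<subseteq> coding_map S K ` critical_words m S K"
  proof
    fix x assume x: "x \<in> critical_points m S K"
    then have "x \<in> K" using K_eq by (auto simp: critical_points_def)
    then show "x \<in> coding_map S K ` critical_words m S K"
      using x by (rule_tac every_point_coded[of x]) (auto simp: critical_words_def)
  qed
  ultimately show ?thesis by (meson finite_surj)
qed

lemma finite_overlap: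
  assumes "post_critically_finite m S K"
    and "set v \<subseteq> {1..m}" "set w \<subseteq> {1..m}" "v \<parallel> w"
  shows "finite (basic_cube S K v \<inter> basic_cube S K w)"
proof -
  obtain u i j v' w' where ij: "i \<noteq> j" and v: "v = u @ i # v'" and w: "w = u @ j # w'"
    using parallel_decomp[OF assms(4)] by blast
  have "prefix (u @ [i]) v" "prefix (u @ [j]) w" unfolding v w by simp_all
  then have "basic_cube S K v \<subseteq> basic_cube S K (u @ [i])" "basic_cube S K w \<subseteq> basic_cube S K (u @ [j])"
    using assms(2,3) basic_cube_antimono by blast+
  then have "basic_cube S K v \<inter> basic_cube S K w
      \<subseteq> word_map S u ` (S i ` K) \<inter> word_map S u ` (S j ` K)"
    unfolding basic_cube_append by (auto simp: basic_cube_def word_map_Cons)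
  also have "\<dots> = word_map S u ` (S i ` K \<inter> S j ` K)"
    using word_map_inj[of u] assms(2) v by (simp add: image_Int)
  also have "\<dots> \<subseteq> word_map S u ` critical_points m S K"
  proof (rule image_mono)
    have "i \<in> {1..m}" "j \<in> {1..m} - {i}" using ij assms(2,3) v w by auto
    then show "S i ` K \<inter> S j ` K \<subseteq> critical_points m S K"
      unfolding critical_points_def by blast
  qed
  finally show ?thesis using finite_critical_points[OF assms(1)] finite_surj by blast
qed

end

section \<open>Lebesgue differentiation along basic cubes\<close>

theorem theorem4p1:
  fixes m :: nat and S :: "nat \<Rightarrow> real ^ 'd \<Rightarrow> real ^ 'd" and p :: "nat \<Rightarrow> real"
    and K :: "(real ^ 'd) set" and \<mu> :: "(real ^ 'd) measure" and f :: "real ^ 'd \<Rightarrow> real"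
  assumes "\<forall>i\<in>{1..m}. contracting_similarity (S i)"
    and "\<not> (\<exists>x. \<forall>i\<in>{1..m}. S i x = x)"
    and "self_similar_set m S K"
    and "probability_vector m p"
    and "self_similar_measure m S p \<mu>"
    and "post_critically_finite m S K"
    and "locally_integrable_on K \<mu> f"
  shows "(AE x in \<mu>. x \<in> K \<longrightarrow> (\<forall>w. basic_cube_choice m S K x w \<longrightarrow>
            (\<lambda>n. 1 / measure \<mu> (basic_cube S K (w n)) * (LINT y:basic_cube S K (w n)|\<mu>. f y))
              \<longlonglongrightarrow> f x)) \<and>
         (AE x in \<mu>. x \<in> K \<longrightarrow> (\<forall>w. basic_cube_choice m S K x w \<longrightarrow>
            (\<lambda>n. 1 / measure \<mu> (basic_cube S K (w n)) * (LINT y:basic_cube S K (w n)|\<mu>. \<bar>f y - f x\<bar>))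
              \<longlonglongrightarrow> 0))"
proof -
  have "prob_space \<mu>" and borel: "sets \<mu> = sets borel"
    using assms(5) unfolding self_similar_measure_def by blast+
  interpret prob_space \<mu> by fact
  interpret similarity_system m S K using assms(1,3) by unfold_locales auto
  define W where "W = {w. set w \<subseteq> {1..m}}"
  let ?Q = "basic_cube S K"
  have Q_sets: "?Q w \<in> sets \<mu>" if "w \<in> W" for w
    using that basic_cube_compact borel by (auto simp: W_def intro: borel_compact)
  have null: "?Q u \<inter> ?Q w \<in> null_sets \<mu>" if "u \<in> W" "w \<in> W" "u \<parallel> w" for u w
  proof -
    have "finite (?Q u \<inter> ?Q w)" using finite_overlap assms(6) that by (auto simp: W_def)
    moreover have "{x} \<in> null_sets \<mu>" for x
      using self_similar_measure_no_atoms[OF assms(1,2,4,5), of x] borel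
      by (intro null_setsI) (auto simp: emeasure_eq_measure)
    ultimately have "(\<Union>x\<in>?Q u \<inter> ?Q w. {x}) \<in> null_sets \<mu>"
      by (intro null_sets_UN') (auto intro: countable_finite)
    then show ?thesis by simp
  qed
  \<comment> \<open>Only \<open>f\<close> on \<open>K\<close> is known to be integrable; \<open>K\<close> is compact, so its extension by zero is.\<close>
  define F where "F x = indicator K x * f x" for x
  have "integrable \<mu> F"
    using assms(7) K_compact
    by (auto simp: F_def[abs_def] locally_integrable_on_def set_integrable_def)
  have F_eq: "F x = f x" if "x \<in> K" for x using that by (simp add: F_def)
  have lebesgue: "AE x in \<mu>. \<forall>\<epsilon>>0. \<exists>\<delta>>0. \<forall>w\<in>W. x \<in> ?Q w \<longrightarrow> ?Q w \<subseteq> ball x \<delta> \<longrightarrow>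
      (LINT y:?Q w|\<mu>. \<bar>F y - F x\<bar>) \<le> \<epsilon> * measure \<mu> (?Q w)"
    by (rule ae_lebesgue_point)
       (use \<open>integrable \<mu> F\<close> Q_sets null basic_cube_antimono borel finite_measure_axioms
        in \<open>auto simp: W_def\<close>)
  \<comment> \<open>A point in a cube of measure zero lies in one of countably many null sets. Off these, division
    by the measure of the cube is meaningful.\<close>
  have positive: "AE x in \<mu>. \<forall>w. w \<in> W \<longrightarrow> x \<in> ?Q w \<longrightarrow> 0 < measure \<mu> (?Q w)"
  proof (simp only: AE_all_countable, intro allI)
    fix w
    show "AE x in \<mu>. w \<in> W \<longrightarrow> x \<in> ?Q w \<longrightarrow> 0 < measure \<mu> (?Q w)"
    proof (cases "w \<in> W \<and> measure \<mu> (?Q w) = 0")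
      case True
      then have "?Q w \<in> null_sets \<mu>"
        using Q_sets by (intro null_setsI) (auto simp: emeasure_eq_measure)
      then have "AE x in \<mu>. x \<notin> ?Q w" by (rule AE_not_in)
      then show ?thesis by eventually_elim simp
    qed (auto simp: zero_less_measure_iff)
  qed
  have both: "(\<lambda>n. 1 / measure \<mu> (?Q (w n)) * (LINT y:?Q (w n)|\<mu>. f y)) \<longlonglongrightarrow> f x \<and>
      (\<lambda>n. 1 / measure \<mu> (?Q (w n)) * (LINT y:?Q (w n)|\<mu>. \<bar>f y - f x\<bar>)) \<longlonglongrightarrow> 0"
    if lp: "\<forall>\<epsilon>>0. \<exists>\<delta>>0. \<forall>w\<in>W. x \<in> ?Q w \<longrightarrow> ?Q w \<subseteq> ball x \<delta> \<longrightarrow>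
        (LINT y:?Q w|\<mu>. \<bar>F y - F x\<bar>) \<le> \<epsilon> * measure \<mu> (?Q w)"
      and pos: "\<forall>w. w \<in> W \<longrightarrow> x \<in> ?Q w \<longrightarrow> 0 < measure \<mu> (?Q w)"
      and "x \<in> K" and choice: "basic_cube_choice m S K x w" for x w
  proof -
    have w: "w n \<in> W" "length (w n) = n" "x \<in> ?Q (w n)" "0 < measure \<mu> (?Q (w n))" "?Q (w n) \<subseteq> K"
      if "1 \<le> n" for n
      using choice pos that basic_cube_subset
      by (auto simp: basic_cube_choice_def words_def W_def)
    let ?osc = "\<lambda>n. 1 / measure \<mu> (?Q (w n)) * (LINT y:?Q (w n)|\<mu>. \<bar>f y - f x\<bar>)"
    have osc_nonneg: "0 \<le> ?osc n" for n
      unfolding set_lebesgue_integral_def by (intro mult_nonneg_nonneg integral_nonneg) auto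
    have osc: "?osc \<longlonglongrightarrow> 0"
    proof (rule LIMSEQ_I)
      fix \<epsilon> :: real assume "0 < \<epsilon>"
      then have "0 < \<epsilon> / 2" by simp
      with lp obtain \<delta> where "0 < \<delta>" and \<delta>: "\<And>v. v \<in> W \<Longrightarrow> x \<in> ?Q v \<Longrightarrow> ?Q v \<subseteq> ball x \<delta> \<Longrightarrow>
        (LINT y:?Q v|\<mu>. \<bar>F y - F x\<bar>) \<le> \<epsilon> / 2 * measure \<mu> (?Q v)" by meson
      obtain N where N: "\<And>w x y. set w \<subseteq> {1..m} \<Longrightarrow> N \<le> length w \<Longrightarrow>
        x \<in> ?Q w \<Longrightarrow> y \<in> ?Q w \<Longrightarrow> dist x y < \<delta>"
        using basic_cubes_shrink[OF \<open>0 < \<delta>\<close>] by blast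
      have "norm (?osc n - 0) < \<epsilon>" if "max 1 N \<le> n" for n
      proof -
        have n: "1 \<le> n" "N \<le> n" using that by auto
        have "?Q (w n) \<subseteq> ball x \<delta>"
          using N[of "w n" x] w[OF n(1)] n by (auto simp: W_def)
        then have "(LINT y:?Q (w n)|\<mu>. \<bar>F y - F x\<bar>) \<le> \<epsilon> / 2 * measure \<mu> (?Q (w n))"
          using \<delta> w[OF n(1)] by simp
        moreover have "(LINT y:?Q (w n)|\<mu>. \<bar>F y - F x\<bar>) = (LINT y:?Q (w n)|\<mu>. \<bar>f y - f x\<bar>)"
          using w[OF n(1)] Q_sets \<open>x \<in> K\<close>
          by (intro set_lebesgue_integral_cong) (auto simp: F_eq)
        ultimately have "?osc n \<le> \<epsilon> / 2" using w(4)[OF n(1)] by (simp add: field_simps)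
        then have "?osc n < \<epsilon>" using \<open>0 < \<epsilon>\<close> by linarith
        then show ?thesis
          using osc_nonneg[of n] by (simp only: diff_zero real_norm_def abs_of_nonneg)
      qed
      then show "\<exists>N. \<forall>n\<ge>N. norm (?osc n - 0) < \<epsilon>" by blast
    qed
    moreover have "(\<lambda>n. 1 / measure \<mu> (?Q (w n)) * (LINT y:?Q (w n)|\<mu>. f y)) \<longlonglongrightarrow> f x"
    proof (rule LIM_zero_cancel, rule Lim_null_comparison[OF _ osc])
      show "\<forall>\<^sub>F n in sequentially.
        norm (1 / measure \<mu> (?Q (w n)) * (LINT y:?Q (w n)|\<mu>. f y) - f x) \<le> ?osc n"
        unfolding eventually_sequentially
      proof (intro exI[of _ 1] allI impI)
        fix n :: nat assume n: "1 \<le> n"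
        let ?M = "measure \<mu> (?Q (w n))"
        have Q [measurable]: "?Q (w n) \<in> sets \<mu>" using Q_sets w(1)[OF n] .
        have f_int: "set_integrable \<mu> (?Q (w n)) f"
          using assms(7) basic_cube_compact w(1,5)[OF n]
          by (auto simp: locally_integrable_on_def W_def)
        have c_int: "set_integrable \<mu> (?Q (w n)) (\<lambda>_. f x)"
          unfolding set_integrable_def by (intro integrable_real_indicator Q
              integrable_scaleR_left) (simp add: emeasure_eq_measure)
        have "(LINT y:?Q (w n)|\<mu>. f y - f x) = (LINT y:?Q (w n)|\<mu>. f y) - ?M * f x"
          using f_int c_int Q
          by (subst set_integral_diff) (auto simp: set_lebesgue_integral_def)
        then have "1 / ?M * (LINT y:?Q (w n)|\<mu>. f y) - f x
            = 1 / ?M * (LINT y:?Q (w n)|\<mu>. f y - f x)"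
          using w(4)[OF n] by (simp add: field_simps)
        moreover have "\<bar>LINT y:?Q (w n)|\<mu>. f y - f x\<bar> \<le> (LINT y:?Q (w n)|\<mu>. \<bar>f y - f x\<bar>)"
          using set_integral_norm_bound[OF set_integral_diff(1)[OF f_int c_int]] by simp
        ultimately show "norm (1 / ?M * (LINT y:?Q (w n)|\<mu>. f y) - f x) \<le> ?osc n"
          using w(4)[OF n] by (simp add: abs_mult divide_right_mono)
      qed
    qed
    ultimately show ?thesis by blast
  qed
  have "AE x in \<mu>. x \<in> K \<longrightarrow> (\<forall>w. basic_cube_choice m S K x w \<longrightarrow>
      (\<lambda>n. 1 / measure \<mu> (?Q (w n)) * (LINT y:?Q (w n)|\<mu>. f y)) \<longlonglongrightarrow> f x \<and>
      (\<lambda>n. 1 / measure \<mu> (?Q (w n)) * (LINT y:?Q (w n)|\<mu>. \<bar>f y - f x\<bar>)) \<longlonglongrightarrow> 0)"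
    using lebesgue positive by eventually_elim (use both in blast)
  then show ?thesis by (intro conjI; eventually_elim) blast+
qed

end
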